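(* Let $\mathcal{C}=\{1,\dots,n_{\mathrm c}\}$ be a finite set of colors, $\mathcal{T}$ a finite set of Wang tiles with colors in $\mathcal{C}$, and let $\mathcal{H}=\{1,\dots,n_{\mathrm h}\}$, $\mathcal{W}=\{1,\dots,n_{\mathrm w}\}$. Consider the binary program: find $x_{i,j,k}\in\{0,1\}$, $(i,j,k)\in\mathcal{H}\times\mathcal{W}\times\mathcal{T}$, such that $$\sum_{k\in\mathcal{T}} x_{i,j,k}[c_k^{\mathrm s}=\ell]-\sum_{k\in\mathcal{T}} x_{i+1,j,k}[c_k^{\mathrm n}=\ell]=0\quad\forall (i,j,\ell)\in(\mathcal{H}\setminus\{n_{\mathrm h}\})\times\mathcal{W}\times\mathcal{C},$$ $$\sum_{k\in\mathcal{T}} x_{i,j,k}[c_k^{\mathrm e}=\ell]-\sum_{k\in\mathcal{T}} x_{i,j+1,k}[c_k^{\mathrm w}=\ell]=0\quad\forall (i,j,\ell)\in\mathcal{H}\times(\mathcal{W}\setminus\{n_{\mathrm w}\})\times\mathcal{C},$$ $$\sum_{k\in\mathcal{T}}x_{i,j,k}=1\quad\forall (i,j)\in\{1,n_{\mathrm h}\}\times\mathcal{W},\qquad \sum_{k\in\mathcal{T}}x_{i,j,k}=1\quad\forall (i,j)\in\mathcal{H}\times\{1,n_{\mathrm w}\}.$$ This program is a complete representation of the bounded tiling problem: every valid tiling $\mathfrak{T}:\mathcal{H}\times\mathcal{W}\to\mathcal{T}$ gives a feasible solution via $x_{i,j,k}=[\mathfrak{T}(i,j)=k]$, and conversely every feasible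 solution is of this form for some valid tiling $\mathfrak{T}:\mathcal{H}\times\mathcal{W}\to\mathcal{T}$.
   Context: A Wang tile $k$ is a quadruple of colors $(c_k^{\mathrm n},c_k^{\mathrm w},c_k^{\mathrm s},c_k^{\mathrm e})\in\mathcal{C}^4$ (north, west, south, east edge of a non-rotatable unit square). Coordinate $(i,j)$ denotes row $i$ (counted downwards) and column $j$ (counted to the right). A valid tiling of the rectangle $\mathcal{H}\times\mathcal{W}$ is a map $\mathfrak{T}:\mathcal{H}\times\mathcal{W}\to\mathcal{T}$ with $c^{\mathrm s}_{\mathfrak{T}(i,j)}=c^{\mathrm n}_{\mathfrak{T}(i+1,j)}$ whenever $(i,j),(i+1,j)\in\mathcal{H}\times\mathcal{W}$, and $c^{\mathrm e}_{\mathfrak{T}(i,j)}=c^{\mathrm w}_{\mathfrak{T}(i,j+1)}$ whenever $(i,j),(i,j+1)\in\mathcal{H}\times\mathcal{W}$. $[P]$ is the Iverson bracket: $1$ if $P$ holds, $0$ otherwise. *)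

theory Defs
  imports Main "HOL-Library.FuncSet"
begin

datatype 'c wang_tile =
  Wang_Tile (north: 'c) (west: 'c) (south: 'c) (east: 'c)

definition colored_in :: "'c set \<Rightarrow> 'c wang_tile \<Rightarrow> bool" where
  "colored_in C k \<longleftrightarrow> north k \<in> C \<and> west k \<in> C \<and> south k \<in> C \<and> east k \<in> C"

text \<open>Coordinates are (row, column), rows counted downwards and columns to the right.
  A map on \<open>H \<times> W\<close> is a total function whose values outside \<open>H \<times> W\<close> are irrelevant.\<close>

definition valid_tiling ::
  "nat set \<Rightarrow> nat set \<Rightarrow> 'c wang_tile set \<Rightarrow> (nat \<times> nat \<Rightarrow> 'c wang_tile) \<Rightarrow> bool" where
  "valid_tiling H W T t \<longleftrightarrow>
     t \<in> H \<times> W \<rightarrow> T \<and>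
     (\<forall>i j. (i, j) \<in> H \<times> W \<and> (i + 1, j) \<in> H \<times> W \<longrightarrow> south (t (i, j)) = north (t (i + 1, j))) \<and>
     (\<forall>i j. (i, j) \<in> H \<times> W \<and> (i, j + 1) \<in> H \<times> W \<longrightarrow> east (t (i, j)) = west (t (i, j + 1)))"

text \<open>The unknowns \<open>x (i, j, k)\<close> are constrained only for \<open>(i, j, k)\<close> in
  \<open>{1..nh} \<times> {1..nw} \<times> T\<close> (when \<open>nh\<close> and \<open>nw\<close> are positive);
  \<open>of_bool\<close> is the Iverson bracket.\<close>

definition feasible ::
  "nat \<Rightarrow> nat \<Rightarrow> nat \<Rightarrow> nat wang_tile set \<Rightarrow> (nat \<times> nat \<times> nat wang_tile \<Rightarrow> int) \<Rightarrow> bool" where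
  "feasible nc nh nw T x \<longleftrightarrow>
     (let C = {1..nc}; H = {1..nh}; W = {1..nw} in
       (\<forall>(i, j, k) \<in> H \<times> W \<times> T. x (i, j, k) \<in> {0, 1}) \<and>
       (\<forall>(i, j, l) \<in> (H - {nh}) \<times> W \<times> C.
          (\<Sum>k\<in>T. x (i, j, k) * of_bool (south k = l))
            - (\<Sum>k\<in>T. x (i + 1, j, k) * of_bool (north k = l)) = 0) \<and>
       (\<forall>(i, j, l) \<in> H \<times> (W - {nw}) \<times> C.
          (\<Sum>k\<in>T. x (i, j, k) * of_bool (east k = l))
            - (\<Sum>k\<in>T. x (i, j + 1, k) * of_bool (west k = l)) = 0) \<and>
       (\<forall>(i, j) \<in> {1, nh} \<times> W. (\<Sum>k\<in>T. x (i, j, k)) = 1) \<and>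
       (\<forall>(i, j) \<in> H \<times> {1, nw}. (\<Sum>k\<in>T. x (i, j, k)) = 1))"

end

theory Submission
  imports Defs
begin

text \<open>Summing the color-matching constraints over all colors shows that vertically adjacent
  cells carry the same number of tiles. Since each cell of the first row carries exactly one,
  so does every cell. A binary vector with sum one is the indicator of a single tile, and for
  indicators the color-matching constraints are precisely the edge conditions of a valid tiling.\<close>

text \<open>Once the sums are swapped, each \<open>k\<close> is counted for exactly one
  \<open>l\<close>, because \<open>c k\<close> lies in \<open>C\<close>. This is the bridge from the
  constraints, which are stated color by color, to the plain number of tiles in a cell.\<close>

lemma sum_by_color:
  fixes f :: "'a \<Rightarrow> 'b::comm_semiring_1"
  assumes "finite C" and "\<forall>k\<in>T. c k \<in> C"
  shows "(\<Sum>l\<in>C. \<Sum>k\<in>T. f k * of_bool (c k = l)) = (\<Sum>k\<in>T. f k)"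
proof -
  have "(\<Sum>l\<in>C. \<Sum>k\<in>T. f k * of_bool (c k = l)) = (\<Sum>k\<in>T. \<Sum>l\<in>C. f k * of_bool (c k = l))"
    by (rule sum.swap)
  also have "\<dots> = (\<Sum>k\<in>T. f k)"
    using assms by (intro sum.cong) (auto simp: of_bool_def if_distrib cong: if_cong)
  finally show ?thesis .
qed

lemma sum_indicator_mult:
  fixes g :: "'a \<Rightarrow> 'b::comm_semiring_1"
  assumes "finite T" and "a \<in> T"
  shows "(\<Sum>k\<in>T. of_bool (a = k) * g k) = g a"
  using assms by (simp add: of_bool_def if_distrib[of "\<lambda>z. z * _"] cong: if_cong)

text \<open>Some entry is nonzero, hence equal to 1, and it already exhausts the total. The
  remaining entries are nonnegative with sum 0, so they all vanish.\<close>

lemma binary_sum_1_imp_indicator: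
  fixes f :: "'a \<Rightarrow> int"
  assumes "finite T" and bin: "\<forall>k\<in>T. f k \<in> {0, 1}" and sum1: "(\<Sum>k\<in>T. f k) = 1"
  shows "\<exists>a\<in>T. \<forall>k\<in>T. f k = of_bool (a = k)"
proof -
  obtain a where a: "a \<in> T" "f a \<noteq> 0"
    using sum1 by (metis sum.neutral zero_neq_one)
  have "f a = 1"
    using a bin by auto
  then have "(\<Sum>k\<in>T - {a}. f k) = 0"
    using sum1 sum.remove[OF \<open>finite T\<close> a(1), of f] by simp
  moreover have "\<forall>k\<in>T - {a}. 0 \<le> f k"
    using bin by auto
  ultimately have "\<forall>k\<in>T - {a}. f k = 0"
    using \<open>finite T\<close> by (subst (asm) sum_nonneg_eq_0_iff) auto
  then show ?thesis
    using a(1) \<open>f a = 1\<close> by (intro bexI[of _ a]) auto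
qed

lemma valid_tiling_imp_feasible:
  assumes "nh \<ge> 1" and "nw \<ge> 1" and fin: "finite T"
    and t: "valid_tiling {1..nh} {1..nw} T t"
  shows "feasible nc nh nw T (\<lambda>(i, j, k). of_bool (t (i, j) = k))"
proof -
  have tT: "t (i, j) \<in> T" if "i \<in> {1..nh}" "j \<in> {1..nw}" for i j
    using t that unfolding valid_tiling_def by blast
  have one: "(\<Sum>k\<in>T. of_bool (t (i, j) = k)) = (1::int)" if "i \<in> {1..nh}" "j \<in> {1..nw}" for i j
    using sum_indicator_mult[OF fin tT[OF that], of "\<lambda>_. 1::int"] by simp
  have vert: "south (t (i, j)) = north (t (i + 1, j))"
    if "i \<in> {1..nh}" "i + 1 \<in> {1..nh}" "j \<in> {1..nw}" for i j
    using t that unfolding valid_tiling_def by blast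
  have horiz: "east (t (i, j)) = west (t (i, j + 1))"
    if "i \<in> {1..nh}" "j \<in> {1..nw}" "j + 1 \<in> {1..nw}" for i j
    using t that unfolding valid_tiling_def by blast
  \<comment> \<open>Each sum collapses to the Iverson bracket of the one tile present, so
    \<open>vert\<close> makes both sides equal. Excluding row \<open>nh\<close> keeps
    \<open>i + 1\<close> inside the grid, where \<open>t\<close> is known to take values in
    \<open>T\<close>.\<close>
  have v: "(\<Sum>k\<in>T. of_bool (t (i, j) = k) * of_bool (south k = l))
      = (\<Sum>k\<in>T. of_bool (t (i + 1, j) = k) * (of_bool (north k = l) :: int))"
    if "i \<in> {1..nh} - {nh}" "j \<in> {1..nw}" for i j l
  proof -
    have i: "i \<in> {1..nh}" "i + 1 \<in> {1..nh}"
      using that by auto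
    show ?thesis
      by (simp only: sum_indicator_mult[OF fin tT] i that vert)
  qed
  have h: "(\<Sum>k\<in>T. of_bool (t (i, j) = k) * of_bool (east k = l))
      = (\<Sum>k\<in>T. of_bool (t (i, j + 1) = k) * (of_bool (west k = l) :: int))"
    if "i \<in> {1..nh}" "j \<in> {1..nw} - {nw}" for i j l
  proof -
    have j: "j \<in> {1..nw}" "j + 1 \<in> {1..nw}"
      using that by auto
    show ?thesis
      by (simp only: sum_indicator_mult[OF fin tT] j that horiz)
  qed
  show ?thesis
    unfolding feasible_def Let_def
  proof (intro conjI)
    \<comment> \<open>Positivity of \<open>nh\<close> puts the rows 1 and \<open>nh\<close> inside
      the grid, so that \<open>one\<close> applies; the columns 1 and \<open>nw\<close> are treated
      alike below.\<close>
    show "\<forall>(i, j)\<in>{1, nh} \<times> {1..nw}.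
        (\<Sum>k\<in>T. case (i, j, k) of (i, j, k) \<Rightarrow> of_bool (t (i, j) = k)) = (1::int)"
      using one assms(1) by auto
    show "\<forall>(i, j)\<in>{1..nh} \<times> {1, nw}.
        (\<Sum>k\<in>T. case (i, j, k) of (i, j, k) \<Rightarrow> of_bool (t (i, j) = k)) = (1::int)"
      using one assms(2) by auto
  \<comment> \<open>What is left is binarity, immediate for \<open>of_bool\<close>, and the two
    families of color-matching constraints.\<close>
  qed (use v h in auto)
qed

lemma feasible_binary:
  assumes "feasible nc nh nw T x" and "i \<in> {1..nh}" and "j \<in> {1..nw}" and "k \<in> T"
  shows "x (i, j, k) \<in> {0, 1}"
  using bspec[OF assms(1)[unfolded feasible_def Let_def, THEN conjunct1], of "(i, j, k)"]
    assms(2-4) by simp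

lemma feasible_vertical:
  assumes "feasible nc nh nw T x"
    and "i \<in> {1..nh} - {nh}" and "j \<in> {1..nw}" and "l \<in> {1..nc}"
  shows "(\<Sum>k\<in>T. x (i, j, k) * of_bool (south k = l))
    = (\<Sum>k\<in>T. x (i + 1, j, k) * of_bool (north k = l))"
  using bspec[OF assms(1)[unfolded feasible_def Let_def, THEN conjunct2, THEN conjunct1],
      of "(i, j, l)"] assms(2-4) by simp

lemma feasible_horizontal:
  assumes "feasible nc nh nw T x"
    and "i \<in> {1..nh}" and "j \<in> {1..nw} - {nw}" and "l \<in> {1..nc}"
  shows "(\<Sum>k\<in>T. x (i, j, k) * of_bool (east k = l))
    = (\<Sum>k\<in>T. x (i, j + 1, k) * of_bool (west k = l))"
  using bspec[OF assms(1)[unfolded feasible_def Let_def, THEN conjunct2, THEN conjunct2,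
      THEN conjunct1], of "(i, j, l)"] assms(2-4) by simp

lemma feasible_first_row:
  assumes "feasible nc nh nw T x" and "j \<in> {1..nw}"
  shows "(\<Sum>k\<in>T. x (1, j, k)) = 1"
  using bspec[OF assms(1)[unfolded feasible_def Let_def, THEN conjunct2, THEN conjunct2,
      THEN conjunct2, THEN conjunct1], of "(1, j)"] assms(2) by simp

text \<open>The program prescribes the sum on border cells only. Interior cells inherit it by
  induction down column \<open>j\<close>, starting from the first row.\<close>

lemma feasible_cell_sum:
  assumes colors: "\<forall>k\<in>T. colored_in {1..nc} k"
    and x: "feasible nc nh nw T x"
    and i: "i \<in> {1..nh}" and j: "j \<in> {1..nw}"
  shows "(\<Sum>k\<in>T. x (i, j, k)) = 1"
proof -
  have "1 \<le> i" "i \<le> nh"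
    using i by auto
  then show ?thesis
  proof (induction i rule: dec_induct)
    case base
    show ?case
      by (rule feasible_first_row[OF x j])
  next
    case (step i)
    have eq: "(\<Sum>k\<in>T. x (i, j, k) * of_bool (south k = l))
        = (\<Sum>k\<in>T. x (i + 1, j, k) * of_bool (north k = l))" if "l \<in> {1..nc}" for l
      using step.hyps step.prems j that by (intro feasible_vertical[OF x]) auto
    \<comment> \<open>The lower cell is sorted by north color, the constraints exchange this for the
      upper cell sorted by south color, and the sorting is then undone. No color escapes the
      constraints, since all colors of \<open>T\<close> lie in \<open>{1..nc}\<close>.\<close>
    have "(\<Sum>k\<in>T. x (i + 1, j, k))
        = (\<Sum>l\<in>{1..nc}. \<Sum>k\<in>T. x (i + 1, j, k) * of_bool (north k = l))"
      using colors by (intro sum_by_color[symmetric]) (auto simp: colored_in_def)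
    also have "\<dots> = (\<Sum>l\<in>{1..nc}. \<Sum>k\<in>T. x (i, j, k) * of_bool (south k = l))"
      by (rule sum.cong) (simp_all only: eq)
    also have "\<dots> = (\<Sum>k\<in>T. x (i, j, k))"
      using colors by (intro sum_by_color) (auto simp: colored_in_def)
    finally show ?case
      using step by simp
  qed
qed

lemma feasible_imp_valid_tiling:
  assumes fin: "finite T"
    and colors: "\<forall>k\<in>T. colored_in {1..nc} k"
    and x: "feasible nc nh nw T x"
  shows "\<exists>t. valid_tiling {1..nh} {1..nw} T t \<and>
    (\<forall>(i, j, k) \<in> {1..nh} \<times> {1..nw} \<times> T. x (i, j, k) = of_bool (t (i, j) = k))"
proof -
  have "\<exists>a\<in>T. \<forall>k\<in>T. x (i, j, k) = of_bool (a = k)" if "i \<in> {1..nh}" "j \<in> {1..nw}" for i j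
  proof (rule binary_sum_1_imp_indicator[OF fin])
    show "\<forall>k\<in>T. x (i, j, k) \<in> {0, 1}"
      using feasible_binary[OF x that] by blast
    show "(\<Sum>k\<in>T. x (i, j, k)) = 1"
      by (rule feasible_cell_sum[OF colors x that])
  qed
  \<comment> \<open>Quantifying over pairs lets the choice of one tile per cell yield
    \<open>t\<close> directly as a function of coordinates.\<close>
  then have "\<forall>p\<in>{1..nh} \<times> {1..nw}. \<exists>a\<in>T. \<forall>k\<in>T. x (fst p, snd p, k) = of_bool (a = k)"
    by auto
  then obtain t where t: "\<forall>p\<in>{1..nh} \<times> {1..nw}.
      t p \<in> T \<and> (\<forall>k\<in>T. x (fst p, snd p, k) = of_bool (t p = k))"
    by metis
  have tT: "t (i, j) \<in> T" if "i \<in> {1..nh}" "j \<in> {1..nw}" for i j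
    using t that by blast
  have xt: "x (i, j, k) = of_bool (t (i, j) = k)"
    if "i \<in> {1..nh}" "j \<in> {1..nw}" "k \<in> T" for i j k
    using t that by force
  \<comment> \<open>The edge selector \<open>c\<close> is left arbitrary so that one fact evaluates
    the sums for all four edges.\<close>
  have count: "(\<Sum>k\<in>T. x (i, j, k) * of_bool (c k = l)) = of_bool (c (t (i, j)) = l)"
    if "i \<in> {1..nh}" "j \<in> {1..nw}" for i j l and c :: "nat wang_tile \<Rightarrow> nat"
  proof -
    have "(\<Sum>k\<in>T. x (i, j, k) * of_bool (c k = l))
        = (\<Sum>k\<in>T. of_bool (t (i, j) = k) * of_bool (c k = l))"
      using xt that by (intro sum.cong) auto
    then show ?thesis
      using sum_indicator_mult[OF fin tT[OF that], of "\<lambda>k. of_bool (c k = l)"] by simp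
  qed
  have vert: "south (t (i, j)) = north (t (i + 1, j))"
    if "i \<in> {1..nh}" "i + 1 \<in> {1..nh}" "j \<in> {1..nw}" for i j
  proof -
    \<comment> \<open>At this particular color the left sum is 1, so the right bracket must be 1 as
      well, which forces the north color of the tile below. The constraint for it exists because the
      color of a tile of \<open>T\<close> lies in \<open>{1..nc}\<close>.\<close>
    let ?l = "south (t (i, j))"
    have "(\<Sum>k\<in>T. x (i, j, k) * of_bool (south k = ?l))
        = (\<Sum>k\<in>T. x (i + 1, j, k) * of_bool (north k = ?l))"
      using that colors tT[OF that(1,3)]
      by (intro feasible_vertical[OF x]) (auto simp: colored_in_def)
    then show ?thesis
      unfolding count[OF that(1,3)] count[OF that(2,3)] by (simp split: if_splits)
  qed
  have horiz: "east (t (i, j)) = west (t (i, j + 1))"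
    if "i \<in> {1..nh}" "j \<in> {1..nw}" "j + 1 \<in> {1..nw}" for i j
  proof -
    let ?l = "east (t (i, j))"
    have "(\<Sum>k\<in>T. x (i, j, k) * of_bool (east k = ?l))
        = (\<Sum>k\<in>T. x (i, j + 1, k) * of_bool (west k = ?l))"
      using that colors tT[OF that(1,2)]
      by (intro feasible_horizontal[OF x]) (auto simp: colored_in_def)
    then show ?thesis
      unfolding count[OF that(1,2)] count[OF that(1,3)] by (simp split: if_splits)
  qed
  have "valid_tiling {1..nh} {1..nw} T t"
    unfolding valid_tiling_def using tT vert horiz by blast
  then show ?thesis
    using xt by (intro exI[of _ t]) auto
qed

theorem mainTheorem2:
  fixes nc nh nw :: nat
    and T :: "nat wang_tile set"
  assumes "nh \<ge> 1" and "nw \<ge> 1"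
    and "finite T"
    and "\<forall>k\<in>T. colored_in {1..nc} k"
  shows "(\<forall>t. valid_tiling {1..nh} {1..nw} T t \<longrightarrow>
            feasible nc nh nw T (\<lambda>(i, j, k). of_bool (t (i, j) = k))) \<and>
         (\<forall>x. feasible nc nh nw T x \<longrightarrow>
            (\<exists>t. valid_tiling {1..nh} {1..nw} T t \<and>
                 (\<forall>(i, j, k) \<in> {1..nh} \<times> {1..nw} \<times> T. x (i, j, k) = of_bool (t (i, j) = k))))"
  by (intro conjI allI impI valid_tiling_imp_feasible[OF assms(1-3)]
      feasible_imp_valid_tiling[OF assms(3,4)])

end
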